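(* Let $I_1,I_2$ be two discrete gray scale images with the same number $N$ of pixels, each having $\mu_{1,1}\neq 0$. There exists a scaling $\lambda\in\mathbb{R}_+$ (i.e. $\lambda>0$) such that $\lambda\circ I_1=I_2$ if and only if $T^r_{\rm scale}(I_1)=T^r_{\rm scale}(I_2)$ for all integers $r\ge 2N-2$.
   Context: A discrete gray scale image $I=\{(z_k,\rho(z_k))\}_{k=1}^N$ consists of $N$ pairwise distinct pixel locations $z_k\in\mathbb{C}$ and intensities $\rho(z_k)\in\mathbb{R}_{\ge 0}$. Pixels of zero intensity may be added to or deleted from an image freely, so two images are considered equal if their sets of pairs (location, intensity) with nonzero intensity coincide. Scaling by $\lambda>0$ acts by $\lambda\circ\{(z_k,\rho(z_k))\}_{k=1}^N=\{(\lambda z_k,\rho(z_k))\}_{k=1}^N$ (the intensity is carried along). The complex moments are $\mu_{j,l}=\sum_{k=1}^N z_k^j\bar z_k^l\rho(z_k)$ (with $0^0=1$). The scaling invariant Pascal triangle $T^r_{\rm scale}(I)$ is the triangular array with entries $\binom{n}{l}\mu_{l,n-l}/\mu_{1,1}^{n/2}$, $0\le l\le n\le r$. *)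

theory Defs
  imports "HOL-Analysis.Complex_Transcendental" "HOL-Library.FuncSet"
begin

(* A pixel is a pair (location, intensity). Injectivity of fst says that distinct pixels
   have distinct locations; pixels of zero intensity are allowed and count in the cardinality. *)
definition gray_image :: "(complex \<times> real) set \<Rightarrow> bool" where
  "gray_image I \<longleftrightarrow> finite I \<and> inj_on fst I \<and> (\<forall>(z, \<rho>)\<in>I. 0 \<le> \<rho>)"

(* Equality of images: pixels of zero intensity are disregarded. *)
definition image_eq :: "(complex \<times> real) set \<Rightarrow> (complex \<times> real) set \<Rightarrow> bool" where
  "image_eq I J \<longleftrightarrow> {(z, \<rho>)\<in>I. \<rho> \<noteq> 0} = {(z, \<rho>)\<in>J. \<rho> \<noteq> 0}"

definition scale_image :: "real \<Rightarrow> (complex \<times> real) set \<Rightarrow> (complex \<times> real) set" where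
  "scale_image c I = (\<lambda>(z, \<rho>). (of_real c * z, \<rho>)) ` I"

definition moment :: "(complex \<times> real) set \<Rightarrow> nat \<Rightarrow> nat \<Rightarrow> complex" where
  "moment I j l = (\<Sum>(z, \<rho>)\<in>I. z ^ j * cnj z ^ l * of_real \<rho>)"

(* The array is indexed by the pairs (n, l) with l <= n <= r and is undefined elsewhere, so
   that equality of arrays is entrywise equality. Since moment I 1 1 is a nonnegative real, its
   principal complex power is the usual positive real power whenever it is nonzero. *)
definition pascal_scale :: "nat \<Rightarrow> (complex \<times> real) set \<Rightarrow> (nat \<times> nat \<Rightarrow> complex)" where
  "pascal_scale r I =
     restrict (\<lambda>(n, l). of_nat (n choose l) * moment I l (n - l) / moment I 1 1 powr (of_nat n / 2))
       {(n, l). l \<le> n \<and> n \<le> r}"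

end

theory Submission
  imports Defs "HOL-Computational_Algebra.Polynomial"
begin

text \<open>
  Scaling by \<open>c\<close> multiplies \<open>\<mu>\<^sub>j\<^sub>,\<^sub>l\<close> by \<open>c ^ (j + l)\<close>, so the quotients in the triangle are
  invariant. Conversely, equal triangles determine the only possible scaling factor
  \<open>c = sqrt (\<mu>\<^sub>1\<^sub>,\<^sub>1(I\<^sub>2) / \<mu>\<^sub>1\<^sub>,\<^sub>1(I\<^sub>1))\<close>, and after scaling by it all moments agree. The difference of
  the two intensity functions is then a finitely supported weight that annihilates every power
  of \<open>z\<close>, hence every polynomial; testing it against the polynomial that vanishes on all but one
  point of the support shows that it is zero.
\<close>

text \<open>This is the trivial kernel of a Vandermonde system with distinct nodes, obtained without
  determinants: power sums for every exponent \<open>j\<close> make test polynomials of any degree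
  available.\<close>

lemma power_sums_eq_0_imp_weights_eq_0:
  fixes w :: "'a::idom \<Rightarrow> 'a"
  assumes "finite S" and power_sums: "\<And>j. (\<Sum>z\<in>S. z ^ j * w z) = 0" and "z0 \<in> S"
  shows "w z0 = 0"
proof -
  have annihilates: "(\<Sum>z\<in>S. poly p z * w z) = 0" for p
  proof -
    have "(\<Sum>z\<in>S. poly p z * w z) = (\<Sum>z\<in>S. \<Sum>i\<le>degree p. coeff p i * (z ^ i * w z))"
      by (simp add: poly_altdef sum_distrib_right mult.assoc)
    also have "\<dots> = (\<Sum>i\<le>degree p. coeff p i * (\<Sum>z\<in>S. z ^ i * w z))"
      by (subst sum.swap) (simp add: sum_distrib_left)
    finally show ?thesis by (simp add: power_sums)
  qed
  define p where "p = (\<Prod>s\<in>S - {z0}. [:- s, 1:])"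
  have poly_p: "poly p z = (\<Prod>s\<in>S - {z0}. z - s)" for z
    by (simp add: p_def poly_prod)
  have "poly p z = 0" if "z \<in> S - {z0}" for z
    using that \<open>finite S\<close> by (auto simp: poly_p)
  then have "(\<Sum>z\<in>S. poly p z * w z) = poly p z0 * w z0"
    using \<open>finite S\<close> \<open>z0 \<in> S\<close> by (simp add: sum.remove)
  moreover have "poly p z0 \<noteq> 0"
    using \<open>finite S\<close> by (auto simp: poly_p)
  ultimately show ?thesis
    using annihilates[of p] by simp
qed

text \<open>In a gray image the sum has at most one term. Writing it as a sum makes it total, with
  value 0 off the pixel locations, and lets moments be regrouped by location.\<close>

definition intensity :: "(complex \<times> real) set \<Rightarrow> complex \<Rightarrow> real" where
  "intensity I z = (\<Sum>p\<in>{p \<in> I. fst p = z}. snd p)"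

lemma intensity_eq_0: "z \<notin> fst ` I \<Longrightarrow> intensity I z = 0"
  unfolding intensity_def by (rule sum.neutral) force

lemma intensity_eq:
  assumes "gray_image I" and "(z, \<rho>) \<in> I"
  shows "intensity I z = \<rho>"
proof -
  have "{p \<in> I. fst p = z} = {(z, \<rho>)}"
  proof (intro equalityI subsetI)
    fix p assume "p \<in> {p \<in> I. fst p = z}"
    then show "p \<in> {(z, \<rho>)}"
      using assms inj_onD[of fst I p "(z, \<rho>)"] by (simp add: gray_image_def)
  qed (use assms in simp)
  then show ?thesis by (simp add: intensity_def)
qed

text \<open>The nonzero pixels form the graph of \<open>intensity I\<close> on its support, so
  equality of images can be treated as equality of functions.\<close>

lemma nonzero_pixels_eq:
  assumes "gray_image I"
  shows "{(z, \<rho>)\<in>I. \<rho> \<noteq> 0} = {(z, \<rho>). \<rho> = intensity I z \<and> \<rho> \<noteq> 0}"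
proof -
  have "(z, intensity I z) \<in> I" if "intensity I z \<noteq> 0" for z
    using that intensity_eq_0[of z I] intensity_eq[OF assms] by force
  then show ?thesis
    using intensity_eq[OF assms] by auto
qed

lemma image_eq_iff_intensity_eq:
  assumes "gray_image I" and "gray_image J"
  shows "image_eq I J \<longleftrightarrow> intensity I = intensity J"
proof
  assume "image_eq I J"
  then have eq: "\<rho> = intensity I z \<and> \<rho> \<noteq> 0 \<longleftrightarrow> \<rho> = intensity J z \<and> \<rho> \<noteq> 0" for z \<rho>
    unfolding image_eq_def nonzero_pixels_eq[OF assms(1)] nonzero_pixels_eq[OF assms(2)]
    by (auto simp: set_eq_iff)
  show "intensity I = intensity J"
  proof
    show "intensity I z = intensity J z" for z
      \<comment> \<open>Each instance covers the case that the intensity it mentions is nonzero; if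
        both vanish, they agree anyway.\<close>
      using eq[of "intensity I z" z] eq[of "intensity J z" z] by auto
  qed
next
  assume "intensity I = intensity J"
  then show "image_eq I J"
    by (simp add: image_eq_def nonzero_pixels_eq assms)
qed

text \<open>Added locations carry intensity 0. The freedom in \<open>S\<close> allows two images to
  be summed over one common index set.\<close>

lemma moment_eq_sum_intensity:
  assumes "finite I" and "finite S" and "fst ` I \<subseteq> S"
  shows "moment I j l = (\<Sum>z\<in>S. z ^ j * cnj z ^ l * of_real (intensity I z))"
proof -
  have "moment I j l
      = (\<Sum>z\<in>S. \<Sum>p\<in>{p \<in> I. fst p = z}. fst p ^ j * cnj (fst p) ^ l * of_real (snd p))"
    unfolding moment_def case_prod_unfold by (rule sum.group[symmetric]) (use assms in auto)
  also have "\<dots> = (\<Sum>z\<in>S. z ^ j * cnj z ^ l * of_real (intensity I z))"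
    by (intro sum.cong refl) (simp add: intensity_def sum_distrib_left)
  finally show ?thesis .
qed

lemma image_eq_iff_moment_eq:
  assumes "gray_image I" and "gray_image J"
  shows "image_eq I J \<longleftrightarrow> (\<forall>j l. moment I j l = moment J j l)"
proof -
  define S where "S = fst ` (I \<union> J)"
  have fin: "finite I" "finite J" "finite S" and sub: "fst ` I \<subseteq> S" "fst ` J \<subseteq> S"
    using assms by (auto simp: gray_image_def S_def)
  note moments = moment_eq_sum_intensity[OF fin(1,3) sub(1)]
    moment_eq_sum_intensity[OF fin(2,3) sub(2)]
  have "intensity I = intensity J" if eq: "\<And>j l. moment I j l = moment J j l"
  proof
    fix z
    define w where "w z = complex_of_real (intensity I z - intensity J z)" for z
    have "(\<Sum>z\<in>S. z ^ j * w z) = 0" for j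
      \<comment> \<open>The moments with \<open>l = 0\<close> involve no conjugates and are plain
        power sums in \<open>z\<close>.\<close>
      using eq[of j 0] by (simp add: moments w_def right_diff_distrib sum_subtractf)
    then have "w z = 0" if "z \<in> S"
      using power_sums_eq_0_imp_weights_eq_0 fin(3) that by blast
    moreover have "intensity I z = 0" "intensity J z = 0" if "z \<notin> S"
      using that sub by (auto intro!: intensity_eq_0)
    ultimately show "intensity I z = intensity J z"
      by (cases "z \<in> S") (auto simp: w_def)
  qed
  then show ?thesis
    unfolding image_eq_iff_intensity_eq[OF assms] by (auto simp: moments)
qed

lemma gray_image_scale:
  assumes "gray_image I" and "c \<noteq> 0"
  shows "gray_image (scale_image c I)"
  using assms unfolding gray_image_def scale_image_def
  by (fastforce simp: inj_on_def)

lemma moment_scale: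
  assumes "c \<noteq> 0"
  shows "moment (scale_image c I) j l = of_real c ^ (j + l) * moment I j l"
proof -
  have "inj_on (\<lambda>(z, \<rho>). (complex_of_real c * z, \<rho>)) I"
    using assms by (auto simp: inj_on_def)
  then show ?thesis
    unfolding moment_def scale_image_def
    by (auto simp: sum.reindex sum_distrib_left power_mult_distrib power_add case_prod_unfold
        intro!: sum.cong)
qed

text \<open>Each summand is \<open>(cmod z)\<^sup>2 * \<rho>\<close>, which is nonnegative. Naming
  the square root \<open>s\<close> turns the half-integer powers in the triangle into natural powers
  of \<open>s\<close>.\<close>

lemma moment_1_1_pos:
  assumes "gray_image I" and "moment I 1 1 \<noteq> 0"
  obtains s :: real where "0 < s" and "moment I 1 1 = of_real (s\<^sup>2)"
proof -
  define x where "x = (\<Sum>(z, \<rho>)\<in>I. (cmod z)\<^sup>2 * \<rho>)"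
  have "moment I 1 1 = of_real x"
    unfolding moment_def x_def of_real_sum
    by (intro sum.cong refl) (auto simp: complex_norm_square simp del: of_real_power)
  moreover have "0 \<le> x"
    using assms(1) by (auto simp: x_def gray_image_def intro!: sum_nonneg)
  ultimately show ?thesis
    using assms(2) that[of "sqrt x"] by simp
qed

lemma of_real_square_powr_half:
  assumes "0 < s"
  shows "complex_of_real (s\<^sup>2) powr (of_nat n / 2) = of_real s ^ n"
proof -
  have "complex_of_real (s\<^sup>2) powr (of_nat n / 2) = of_real ((s\<^sup>2) powr (real n / 2))"
    using powr_of_real[of "s\<^sup>2" "real n / 2"] by simp
  also have "(s\<^sup>2) powr (real n / 2) = s ^ n"
    using assms by (simp add: powr_powr powr_realpow flip: powr_numeral)
  finally show ?thesis by simp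
qed

text \<open>Whatever \<open>r0\<close> is, each moment occurs in a triangle with
  \<open>r \<ge> r0\<close>, as entry \<open>j\<close> of row \<open>j + l\<close>.\<close>

lemma pascal_scale_eq_iff:
  assumes "0 < s" and "moment I 1 1 = of_real (s\<^sup>2)"
    and "0 < t" and "moment J 1 1 = of_real (t\<^sup>2)"
  shows "(\<forall>r\<ge>r0. pascal_scale r I = pascal_scale r J) \<longleftrightarrow>
    (\<forall>j l. moment I j l / of_real s ^ (j + l) = moment J j l / of_real t ^ (j + l))"
proof (intro iffI allI impI)
  fix j l
  assume eq: "\<forall>r\<ge>r0. pascal_scale r I = pascal_scale r J"
  \<comment> \<open>The maximum respects the bound \<open>r0\<close> and keeps the index inside the
    domain of \<open>restrict\<close>.\<close>
  have "pascal_scale (max r0 (j + l)) I (j + l, j) = pascal_scale (max r0 (j + l)) J (j + l, j)"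
    using eq by simp
  then show "moment I j l / of_real s ^ (j + l) = moment J j l / of_real t ^ (j + l)"
    unfolding pascal_scale_def assms(2,4)
      of_real_square_powr_half[OF assms(1)] of_real_square_powr_half[OF assms(3)]
    \<comment> \<open>The flipped rule isolates the binomial coefficient, which is nonzero and
      cancels.\<close>
    by (simp flip: times_divide_eq_right)
next
  fix r
  assume eq: "\<forall>j l. moment I j l / of_real s ^ (j + l) = moment J j l / of_real t ^ (j + l)"
  have "moment I l (n - l) / of_real s ^ n = moment J l (n - l) / of_real t ^ n"
    if "l \<le> n" for n l
    using eq[rule_format, of l "n - l"] that by simp
  then show "pascal_scale r I = pascal_scale r J"
    unfolding pascal_scale_def assms(2,4)
      of_real_square_powr_half[OF assms(1)] of_real_square_powr_half[OF assms(3)]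
    by (auto intro!: restrict_ext simp flip: times_divide_eq_right)
qed

theorem lemma6:
  fixes I1 I2 :: "(complex \<times> real) set" and N :: nat
  assumes "gray_image I1" and "gray_image I2"
    and "card I1 = N" and "card I2 = N"
    and "moment I1 1 1 \<noteq> 0" and "moment I2 1 1 \<noteq> 0"
  shows "(\<exists>c::real. 0 < c \<and> image_eq (scale_image c I1) I2) \<longleftrightarrow>
         (\<forall>r\<ge>2 * N - 2. pascal_scale r I1 = pascal_scale r I2)"
proof -
  obtain s where s: "0 < s" "moment I1 1 1 = of_real (s\<^sup>2)"
    using moment_1_1_pos assms(1,5) by blast
  obtain t where t: "0 < t" "moment I2 1 1 = of_real (t\<^sup>2)"
    using moment_1_1_pos assms(2,6) by blast
  have image_eq_scale: "image_eq (scale_image c I1) I2 \<longleftrightarrow>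
      (\<forall>j l. of_real c ^ (j + l) * moment I1 j l = moment I2 j l)" if "0 < c" for c
    using that image_eq_iff_moment_eq[OF gray_image_scale assms(2), OF assms(1), of c]
    by (simp add: moment_scale)
  have factor: "c = t / s" if "0 < c" "image_eq (scale_image c I1) I2" for c
  proof -
    \<comment> \<open>Comparing the moments at \<open>(1, 1)\<close> yields
      \<open>(c * s)\<^sup>2 = t\<^sup>2\<close>, and positivity removes the sign ambiguity.\<close>
    have "complex_of_real c ^ (1 + 1) * moment I1 1 1 = moment I2 1 1"
      using that image_eq_scale by blast
    then have "complex_of_real ((c * s)\<^sup>2) = of_real (t\<^sup>2)"
      by (simp add: s(2) t(2) power_mult_distrib power2_eq_square mult_ac del: One_nat_def)
    then have "(c * s)\<^sup>2 = t\<^sup>2"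
      by (simp only: of_real_eq_iff)
    then have "c * s = t"
      using that(1) s(1) t(1) by (simp add: power2_eq_iff_nonneg)
    then show ?thesis
      using s(1) by (simp add: field_simps)
  qed
  have "(\<exists>c::real. 0 < c \<and> image_eq (scale_image c I1) I2) \<longleftrightarrow>
      image_eq (scale_image (t / s) I1) I2"
    using factor s(1) t(1) by (metis divide_pos_pos)
  also have "\<dots> \<longleftrightarrow>
      (\<forall>j l. moment I1 j l / of_real s ^ (j + l) = moment I2 j l / of_real t ^ (j + l))"
    using s(1) t(1) by (simp add: image_eq_scale field_simps)
  also have "\<dots> \<longleftrightarrow> (\<forall>r\<ge>2 * N - 2. pascal_scale r I1 = pascal_scale r I2)"
    by (rule pascal_scale_eq_iff[OF s t, symmetric])
  finally show ?thesis .
qed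

end
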